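(* Let $f\colon\mathbb{R}^d\to\mathbb{R}$ be convex and differentiable with locally Lipschitz gradient $\nabla f$, and assume that $\min_{x\in\mathbb{R}^d} f(x)$ has a solution. Let $x^0\in\mathbb{R}^d$, $t_0>0$, $\theta_0\ge0$, $\delta\in(0,1)$, and let $\{\gamma_k\}_{k\ge1}$ be a sequence of real numbers with $\gamma_k\ge0$ and $\sum_{k=1}^\infty\gamma_k<\infty$. Let $\{x^k\}$ be generated by the method Extended BB_AdGD-1, that is, $x^{k+1}=x^k-t_k\nabla f(x^k)$ for $k\ge 0$, where for $k\ge1$ $$t_k=\mathrm{mid}\{t_{BB},\,l_k^{(1)},\,u_k^{(1)}\},\qquad t_{BB}=\frac{(x^k-x^{k-1})^T(\nabla f(x^k)-\nabla f(x^{k-1}))}{\|\nabla f(x^k)-\nabla f(x^{k-1})\|^2}.$$ Then every accumulation point of $\{x^k\}$ is an optimal solution of $\min_{x\in\mathbb{R}^d}f(x)$.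
   Context: $\|\cdot\|$ is the Euclidean norm and $\mathrm{mid}\{a,b,c\}$ is the median of three numbers. For $k\ge1$, $L_k=\dfrac{\|\nabla f(x^k)-\nabla f(x^{k-1})\|}{\|x^k-x^{k-1}\|}$, $\theta_k=\dfrac{t_k}{t_{k-1}}$ ($\theta_0$ is a given initial value), and $$l_k^{(1)}=\min\left\{\sqrt{1+\theta_{k-1}}\,t_{k-1},\ \frac{\delta}{\sqrt2 L_k}\right\},\qquad u_k^{(1)}=\min\left\{\sqrt{1+\theta_{k-1}}\,t_{k-1},\ \frac1{L_k}\sqrt{\frac12\left(1+\frac{\gamma_k}{\|x^k-x^{k-1}\|^2}\right)}\right\}.$$ Conventions: the iteration does not terminate, i.e. $\nabla f(x^k)\ne0$ for all $k$ (so $x^k\ne x^{k-1}$). If $L_k=0$ then $c/L_k$ is read as $+\infty$ for $c>0$, and in that case $l_k^{(1)}=u_k^{(1)}=\sqrt{1+\theta_{k-1}}\,t_{k-1}=t_k$ whatever value is assigned to $t_{BB}$. *)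

theory Defs
  imports "HOL-Analysis.Analysis"
begin

definition locally_lipschitz :: "('a::metric_space \<Rightarrow> 'b::metric_space) \<Rightarrow> bool" where
  "locally_lipschitz g \<longleftrightarrow> (\<forall>x. \<exists>r>0. \<exists>L. L-lipschitz_on (cball x r) g)"

definition mid :: "real \<Rightarrow> real \<Rightarrow> real \<Rightarrow> real" where
  "mid a b c = sort [a, b, c] ! 1"

text \<open>Below, \<open>g\<close> is the gradient map and \<open>x\<close>, \<open>t\<close>, \<open>\<theta>\<close> are the sequences of iterates, step sizes
  and step-size ratios; the quantities are meaningful for indices \<open>k \<ge> 1\<close>.\<close>

definition Lk :: "('a::real_inner \<Rightarrow> 'a) \<Rightarrow> (nat \<Rightarrow> 'a) \<Rightarrow> nat \<Rightarrow> real" where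
  "Lk g x k = norm (g (x k) - g (x (k - 1))) / norm (x k - x (k - 1))"

definition t_BB :: "('a::real_inner \<Rightarrow> 'a) \<Rightarrow> (nat \<Rightarrow> 'a) \<Rightarrow> nat \<Rightarrow> real" where
  "t_BB g x k = ((x k - x (k - 1)) \<bullet> (g (x k) - g (x (k - 1)))) / (norm (g (x k) - g (x (k - 1))))\<^sup>2"

text \<open>When \<open>L\<^sub>k = 0\<close>, a quotient \<open>c / L\<^sub>k\<close> with \<open>c > 0\<close> stands for \<open>+\<infinity>\<close>, so the minimum is its
  first argument. Both bounds then coincide, and the median does not depend on the (junk) value of
  \<open>t_BB\<close>.\<close>

definition l1 :: "real \<Rightarrow> ('a::real_inner \<Rightarrow> 'a) \<Rightarrow> (nat \<Rightarrow> 'a) \<Rightarrow> (nat \<Rightarrow> real) \<Rightarrow> (nat \<Rightarrow> real) \<Rightarrow> nat \<Rightarrow> real"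
  where
  "l1 \<delta> g x t \<theta> k =
     (if Lk g x k = 0 then sqrt (1 + \<theta> (k - 1)) * t (k - 1)
      else min (sqrt (1 + \<theta> (k - 1)) * t (k - 1)) (\<delta> / (sqrt 2 * Lk g x k)))"

definition u1 ::
  "(nat \<Rightarrow> real) \<Rightarrow> ('a::real_inner \<Rightarrow> 'a) \<Rightarrow> (nat \<Rightarrow> 'a) \<Rightarrow> (nat \<Rightarrow> real) \<Rightarrow> (nat \<Rightarrow> real) \<Rightarrow> nat \<Rightarrow> real"
  where
  "u1 \<gamma> g x t \<theta> k =
     (if Lk g x k = 0 then sqrt (1 + \<theta> (k - 1)) * t (k - 1)
      else min (sqrt (1 + \<theta> (k - 1)) * t (k - 1))
             (1 / Lk g x k * sqrt (1 / 2 * (1 + \<gamma> k / (norm (x k - x (k - 1)))\<^sup>2))))"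

definition extended_BB_AdGD_1 ::
  "('a::real_inner \<Rightarrow> 'a) \<Rightarrow> real \<Rightarrow> (nat \<Rightarrow> real) \<Rightarrow> (nat \<Rightarrow> 'a) \<Rightarrow> (nat \<Rightarrow> real) \<Rightarrow> (nat \<Rightarrow> real) \<Rightarrow> bool"
  where
  "extended_BB_AdGD_1 g \<delta> \<gamma> x t \<theta> \<longleftrightarrow>
     (\<forall>k. x (Suc k) = x k - t k *\<^sub>R g (x k)) \<and>
     (\<forall>k\<ge>1. \<theta> k = t k / t (k - 1)) \<and>
     (\<forall>k\<ge>1. t k = mid (t_BB g x k) (l1 \<delta> g x t \<theta> k) (u1 \<gamma> g x t \<theta> k))"

definition accumulation_point :: "(nat \<Rightarrow> 'a::topological_space) \<Rightarrow> 'a \<Rightarrow> bool" where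
  "accumulation_point x z \<longleftrightarrow> (\<exists>r. strict_mono r \<and> (x \<circ> r) \<longlonglongrightarrow> z)"

end

theory Submission
  imports Defs
begin

text \<open>
  The proof is an energy argument. Let \<open>y\<close> be a minimiser and write \<open>g\<close> for the gradient. The
  quantity
  \<open>\<parallel>x\<^sub>k\<^sub>+\<^sub>1 - y\<parallel>\<^sup>2 + \<parallel>x\<^sub>k\<^sub>+\<^sub>1 - x\<^sub>k\<parallel>\<^sup>2 + 2 t\<^sub>k (1 + \<theta>\<^sub>k) (f x\<^sub>k - f y)\<close>
  increases by at most \<open>\<gamma>\<^sub>k\<^sub>+\<^sub>1\<close> when \<open>k\<close> is replaced by \<open>k + 1\<close> (\<open>energy_step\<close>). Expanding
  \<open>\<parallel>x\<^sub>k\<^sub>+\<^sub>1 - y\<parallel>\<^sup>2\<close> leaves the harmful term \<open>\<parallel>x\<^sub>k\<^sub>+\<^sub>1 - x\<^sub>k\<parallel>\<^sup>2\<close>, and this term is controlled by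
  the preceding displacement (\<open>displacement_bound\<close>). The upper bound \<open>u1\<close> on the step size is
  made for this: its two arguments limit the growth of \<open>t\<^sub>k\<close> and the size of
  \<open>t\<^sub>k (g x\<^sub>k - g x\<^sub>k\<^sub>-\<^sub>1)\<close>. What matters about the median is that it lies between \<open>l1\<close> and \<open>u1\<close>.

  Since \<open>\<gamma>\<close> is summable, the energy is bounded, hence so are the iterates. On a compact set that
  contains them the gradient is Lipschitz, so the lower bound \<open>l1\<close> keeps the step sizes away from
  zero (\<open>step_sizes_bounded_below\<close>). Moreover \<open>g x\<^sub>k\<close> is bounded, and then the Lipschitz property near \<open>y\<close>
  sharpens the gradient inequality by a term \<open>c \<parallel>g x\<^sub>k\<parallel>\<^sup>2\<close> with \<open>c > 0\<close>
  (\<open>gradient_inequality_at_minimiser\<close>). With this gain the energy also loses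
  \<open>2 c t\<^sub>k \<parallel>g x\<^sub>k\<parallel>\<^sup>2\<close> in the step that produces \<open>x\<^sub>k\<^sub>+\<^sub>1\<close>, so these terms are summable and
  \<open>g x\<^sub>k\<close> tends to zero. By continuity the gradient vanishes at every accumulation point, which is
  therefore a minimiser by convexity.
\<close>

section \<open>Convex functions and their gradients\<close>

lemma convex_gradient_inequality:
  fixes f :: "'a::real_inner \<Rightarrow> real"
  assumes "convex_on UNIV f" and "GDERIV f a :> d"
  shows "f a + d \<bullet> (b - a) \<le> f b"
proof -
  define h where "h = (\<lambda>s::real. f (a + s *\<^sub>R (b - a)))"
  have "convex_on UNIV h"
  proof (rule convex_onI)
    fix s u v :: real
    assume s: "0 < s" "s < 1"
    have "a + ((1 - s) *\<^sub>R u + s *\<^sub>R v) *\<^sub>R (b - a)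
        = (1 - s) *\<^sub>R (a + u *\<^sub>R (b - a)) + s *\<^sub>R (a + v *\<^sub>R (b - a))"
      by (simp add: algebra_simps)
    then show "h ((1 - s) *\<^sub>R u + s *\<^sub>R v) \<le> (1 - s) * h u + s * h v"
      unfolding h_def using convex_onD[OF assms(1), of s] s by simp
  qed simp
  moreover have "(h has_field_derivative d \<bullet> (b - a)) (at 0)"
  proof -
    have "((\<lambda>s::real. a + s *\<^sub>R (b - a)) has_derivative (\<lambda>s. s *\<^sub>R (b - a))) (at 0)"
      by (auto intro!: derivative_eq_intros)
    moreover have "(f has_derivative (\<lambda>w. w \<bullet> d)) (at (a + 0 *\<^sub>R (b - a)))"
      using assms(2) by (simp add: gderiv_def)
    ultimately have "(h has_derivative (\<lambda>s. (s *\<^sub>R (b - a)) \<bullet> d)) (at 0)"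
      unfolding h_def by (rule has_derivative_compose)
    moreover have "(\<lambda>s. (s *\<^sub>R (b - a)) \<bullet> d) = (*) (d \<bullet> (b - a))"
      by (simp add: fun_eq_iff inner_commute)
    ultimately show ?thesis
      by (simp add: has_field_derivative_def)
  qed
  ultimately have "h 1 - h 0 \<ge> (d \<bullet> (b - a)) * (1 - 0)"
    by (intro convex_on_imp_above_tangent[where A = UNIV]) auto
  then show ?thesis by (simp add: h_def)
qed

lemma convex_gradient_monotone:
  fixes f :: "'a::real_inner \<Rightarrow> real"
  assumes "convex_on UNIV f" and "\<And>z. GDERIV f z :> g z"
  shows "(g b - g a) \<bullet> (b - a) \<ge> 0"
  using convex_gradient_inequality[OF assms, of a b] convex_gradient_inequality[OF assms, of b a]
  by (simp add: algebra_simps)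

lemma convex_minimiser_iff_gradient_zero:
  fixes f :: "'a::real_inner \<Rightarrow> real"
  assumes "convex_on UNIV f" and "GDERIV f a :> d"
  shows "(\<forall>z. f a \<le> f z) \<longleftrightarrow> d = 0"
proof
  assume min: "\<forall>z. f a \<le> f z"
  have "(f has_derivative (\<lambda>h. h \<bullet> d)) (at a)"
    using assms(2) by (simp add: gderiv_def)
  then have "(\<lambda>h. h \<bullet> d) = (\<lambda>h. 0)"
    by (rule has_derivative_local_min) (simp add: min)
  then have "d \<bullet> d = 0" by meson
  then show "d = 0" by simp
next
  assume "d = 0"
  then show "\<forall>z. f a \<le> f z"
    using convex_gradient_inequality[OF assms] by simp
qed

text \<open>
  The gain over the plain gradient inequality comes from comparing both points with
  \<open>z = y + s *\<^sub>R g a\<close>: seen from \<open>a\<close>, the value at \<open>z\<close> exceeds the linear prediction at \<open>y\<close> by at least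
  \<open>s \<parallel>g a\<parallel>\<^sup>2\<close>, while it exceeds \<open>f y\<close> only by a term of second order in \<open>s\<close>, because the gradient is
  Lipschitz near \<open>y\<close> and vanishes at \<open>y\<close>. The bound \<open>G\<close> makes it possible to choose one \<open>s\<close> for all
  \<open>a\<close> that keeps \<open>z\<close> in a fixed ball around \<open>y\<close>.
\<close>
lemma gradient_inequality_at_minimiser:
  fixes f :: "'a::real_inner \<Rightarrow> real"
  assumes cvx: "convex_on UNIV f" and grad: "\<And>z. GDERIV f z :> g z"
    and lip: "locally_lipschitz g" and min: "\<And>z. f y \<le> f z"
  shows "\<exists>c>0. \<forall>a. norm (g a) \<le> G \<longrightarrow> f a + g a \<bullet> (y - a) + c * (norm (g a))\<^sup>2 \<le> f y"
proof -
  obtain r K0 where r: "r > 0" and K0: "K0-lipschitz_on (cball y r) g"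
    using lip unfolding locally_lipschitz_def by blast
  define K where "K = K0 + 1"
  have K: "K > 0" and lipK: "K-lipschitz_on (cball y r) g"
    using lipschitz_on_nonneg[OF K0] lipschitz_on_le[OF K0, of K] by (auto simp: K_def)
  have gy: "g y = 0"
    using convex_minimiser_iff_gradient_zero[OF cvx grad] min by blast
  \<comment> \<open>The first bound keeps \<open>z\<close> in the ball where \<open>g\<close> is Lipschitz, the second one makes the
    second-order term at most half of the gain.\<close>
  define s where "s = min (r / (\<bar>G\<bar> + 1)) (1 / (2 * K))"
  have s: "s > 0" "s * (\<bar>G\<bar> + 1) \<le> r" "s * K \<le> 1 / 2"
  proof -
    show "s > 0" using r K by (simp add: s_def)
    have "s \<le> r / (\<bar>G\<bar> + 1)" "s \<le> 1 / (2 * K)" by (simp_all add: s_def)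
    then show "s * (\<bar>G\<bar> + 1) \<le> r" "s * K \<le> 1 / 2"
      using K by (simp_all add: field_simps add_pos_nonneg)
  qed
  show ?thesis
  proof (intro exI[of _ "s / 2"] conjI allI impI)
    show "s / 2 > 0" using s by simp
    fix a assume a: "norm (g a) \<le> G"
    define z where "z = y + s *\<^sub>R g a"
    have "norm (z - y) \<le> s * (\<bar>G\<bar> + 1)"
      using a s(1) by (simp add: z_def)
    then have "z \<in> cball y r"
      using s(2) by (simp add: dist_norm norm_minus_commute)
    then have "norm (g z) \<le> K * norm (z - y)"
      using lipschitz_onD[OF lipK, of z y] r by (simp add: gy dist_norm)
    have "f z \<le> f y + g z \<bullet> (z - y)"
      using convex_gradient_inequality[OF cvx grad, of z y] by (simp add: algebra_simps)
    also have "g z \<bullet> (z - y) \<le> norm (g z) * norm (z - y)"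
      by (rule norm_cauchy_schwarz)
    also have "\<dots> \<le> (K * norm (z - y)) * norm (z - y)"
      by (intro mult_right_mono) (use \<open>norm (g z) \<le> _\<close> in auto)
    also have "\<dots> = (s * K) * (s * (norm (g a))\<^sup>2)"
      using s(1) by (simp add: z_def power2_eq_square)
    also have "\<dots> \<le> (1 / 2) * (s * (norm (g a))\<^sup>2)"
      using s by (intro mult_right_mono) auto
    finally have "f z \<le> f y + s / 2 * (norm (g a))\<^sup>2" by simp
    moreover have "f a + g a \<bullet> (y - a) + s * (norm (g a))\<^sup>2 \<le> f z"
      using convex_gradient_inequality[OF cvx grad, of a z]
      by (simp add: z_def algebra_simps power2_norm_eq_inner)
    ultimately show "f a + g a \<bullet> (y - a) + s / 2 * (norm (g a))\<^sup>2 \<le> f y"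
      by simp
  qed
qed

lemma locally_lipschitz_imp_continuous:
  assumes "locally_lipschitz g"
  shows "isCont g z"
proof -
  obtain r L where r: "r > 0" and "L-lipschitz_on (cball z r) g"
    using assms unfolding locally_lipschitz_def by blast
  then have "continuous_on (cball z r) g"
    by (intro lipschitz_on_continuous_on)
  then show ?thesis
    by (rule continuous_on_interior) (use r in \<open>auto simp: mem_interior_cball\<close>)
qed

lemma locally_lipschitz_compact_imp_lipschitz:
  assumes "locally_lipschitz g" and "compact S"
  obtains L where "L-lipschitz_on S g"
proof -
  have "local_lipschitz {0::real} S (\<lambda>_. g)"
  proof (rule local_lipschitzI)
    fix x :: 'a and u :: real
    obtain r L where "r > 0" "L-lipschitz_on (cball x r) g"
      using assms(1) unfolding locally_lipschitz_def by blast
    then show "\<exists>v>0. \<exists>L. \<forall>u'\<in>cball u v \<inter> {0}. L-lipschitz_on (cball x v \<inter> S) g"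
      by (meson Int_lower1 lipschitz_on_subset)
  qed
  then obtain L where "\<And>u. u \<in> {0::real} \<Longrightarrow> L-lipschitz_on S g"
    by (rule local_lipschitz_compact_implies_lipschitz[OF _ assms(2)]) auto
  then show thesis by (intro that[of L]) simp
qed

section \<open>One step of the method\<close>

text \<open>
  The polarisation identity \<open>\<parallel>g1\<parallel>\<^sup>2 = \<parallel>g1 - g0\<parallel>\<^sup>2 + 2 g1 \<bullet> g0 - \<parallel>g0\<parallel>\<^sup>2\<close> brings in the change of
  the gradient. Monotonicity gives \<open>g1 \<bullet> g0 \<le> \<parallel>g0\<parallel>\<^sup>2\<close>, so the negative square absorbs one of the two
  inner products. With both of them, the same energy argument would need the growth condition
  \<open>\<theta>\<^sub>k\<^sup>2 \<le> 1/2 + \<theta>\<^sub>k\<^sub>-\<^sub>1\<close> instead of \<open>\<theta>\<^sub>k\<^sup>2 \<le> 1 + \<theta>\<^sub>k\<^sub>-\<^sub>1\<close>.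
\<close>
lemma displacement_bound:
  fixes x0 x1 g0 g1 :: "'a::real_inner"
  assumes t0: "t0 > 0" and x1: "x1 = x0 - t0 *\<^sub>R g0"
    and mono: "(g1 - g0) \<bullet> (x1 - x0) \<ge> 0"
    and step: "2 * t1\<^sup>2 * (norm (g1 - g0))\<^sup>2 \<le> (norm (x1 - x0))\<^sup>2 + \<gamma>"
  shows "2 * (norm (t1 *\<^sub>R g1))\<^sup>2
    \<le> (norm (x1 - x0))\<^sup>2 + \<gamma> + 2 * t1 * (t1 / t0) * (g1 \<bullet> (x0 - x1))"
proof -
  have "t0 * ((g0 - g1) \<bullet> g0) \<ge> 0"
    using mono by (simp add: x1 algebra_simps)
  then have "g1 \<bullet> g0 \<le> g0 \<bullet> g0"
    using t0 by (simp add: zero_le_mult_iff inner_diff_left)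
  then have "(norm g1)\<^sup>2 \<le> (norm (g1 - g0))\<^sup>2 + g1 \<bullet> g0"
    by (simp add: power2_norm_eq_inner algebra_simps inner_commute)
  then have "2 * t1\<^sup>2 * (norm g1)\<^sup>2 \<le> 2 * t1\<^sup>2 * ((norm (g1 - g0))\<^sup>2 + g1 \<bullet> g0)"
    by (intro mult_left_mono) auto
  moreover have "2 * t1 * (t1 / t0) * (g1 \<bullet> (x0 - x1)) = 2 * t1\<^sup>2 * (g1 \<bullet> g0)"
    using t0 by (simp add: x1 power2_eq_square)
  ultimately show ?thesis
    using step by (simp add: power_mult_distrib algebra_simps)
qed

text \<open>
  The displacement \<open>\<parallel>x2 - x1\<parallel>\<^sup>2\<close> in the expansion of \<open>\<parallel>x2 - y\<parallel>\<^sup>2\<close> is written as twice itself minus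
  itself: the double is estimated by the preceding displacement, the remainder enters the new energy. The
  resulting term in \<open>f x0 - f y\<close> is paid for by the old energy thanks to the growth
  condition. The constant \<open>c\<close> records a possible gain in the gradient inequality.
\<close>
lemma energy_step:
  fixes f :: "'a::real_inner \<Rightarrow> real"
  assumes cvx: "convex_on UNIV f" and grad: "\<And>z. GDERIV f z :> g z"
    and min: "\<And>z. f y \<le> f z"
    and t0: "t0 > 0" and t1: "t1 > 0"
    and x1: "x1 = x0 - t0 *\<^sub>R g x0" and x2: "x2 = x1 - t1 *\<^sub>R g x1"
    and growth: "(t1 / t0)\<^sup>2 \<le> 1 + \<theta>0"
    and step: "2 * t1\<^sup>2 * (norm (g x1 - g x0))\<^sup>2 \<le> (norm (x1 - x0))\<^sup>2 + \<gamma>"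
    and gain: "f x1 + g x1 \<bullet> (y - x1) + c * (norm (g x1))\<^sup>2 \<le> f y"
  shows "(norm (x2 - y))\<^sup>2 + (norm (x2 - x1))\<^sup>2 + 2 * t1 * (1 + t1 / t0) * (f x1 - f y)
      + 2 * c * t1 * (norm (g x1))\<^sup>2
    \<le> (norm (x1 - y))\<^sup>2 + (norm (x1 - x0))\<^sup>2 + 2 * t0 * (1 + \<theta>0) * (f x0 - f y) + \<gamma>"
proof -
  define q where "q = t1 / t0"
  have disp: "2 * (norm (x2 - x1))\<^sup>2
      \<le> (norm (x1 - x0))\<^sup>2 + \<gamma> + 2 * t1 * q * (g x1 \<bullet> (x0 - x1))"
    using displacement_bound[OF t0 x1 convex_gradient_monotone[OF cvx grad] step]
    by (simp add: x2 q_def)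
  have "2 * t1 * q * (g x1 \<bullet> (x0 - x1)) \<le> 2 * t1 * q * (f x0 - f x1)"
    using convex_gradient_inequality[OF cvx grad, of x1 x0] t0 t1
    unfolding q_def by (intro mult_left_mono) auto
  moreover have "2 * t1 * q * (f x0 - f y) \<le> 2 * t0 * (1 + \<theta>0) * (f x0 - f y)"
  proof -
    have "t1 * q = t0 * q\<^sup>2"
      using t0 by (simp add: q_def power2_eq_square)
    also have "\<dots> \<le> t0 * (1 + \<theta>0)"
      using growth t0 unfolding q_def by (intro mult_left_mono) auto
    finally show ?thesis
      using min by (intro mult_right_mono) auto
  qed
  moreover have "2 * t1 * (g x1 \<bullet> (x1 - y)) \<ge> 2 * t1 * (f x1 - f y + c * (norm (g x1))\<^sup>2)"
    using gain t1 by (intro mult_left_mono) (auto simp: algebra_simps)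
  moreover have "(norm (x2 - y))\<^sup>2
      = (norm (x1 - y))\<^sup>2 - 2 * t1 * (g x1 \<bullet> (x1 - y)) + (norm (x2 - x1))\<^sup>2"
  proof -
    have "(norm (x2 - y))\<^sup>2
        = (norm (x1 - y))\<^sup>2 + 2 * ((x1 - y) \<bullet> (x2 - x1)) + (norm (x2 - x1))\<^sup>2"
      using dot_norm[of "x1 - y" "x2 - x1"] by simp
    moreover have "(x1 - y) \<bullet> (x2 - x1) = - (t1 * (g x1 \<bullet> (x1 - y)))"
      by (simp add: x2 inner_commute)
    ultimately show ?thesis by simp
  qed
  ultimately show ?thesis
    using disp unfolding q_def[symmetric] by (simp add: algebra_simps)
qed

section \<open>The step sizes\<close>

lemma mid_between: "l \<le> u \<Longrightarrow> l \<le> mid a l u \<and> mid a l u \<le> u"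
  by (auto simp: mid_def)

lemma l1_le_u1:
  assumes "0 < \<delta>" "\<delta> < 1" "\<gamma> k \<ge> 0"
  shows "l1 \<delta> g x t \<theta> k \<le> u1 \<gamma> g x t \<theta> k"
proof -
  have L: "Lk g x k \<ge> 0" by (simp add: Lk_def)
  have "sqrt (1 / 2) \<le> sqrt (1 / 2 * (1 + \<gamma> k / (norm (x k - x (k - 1)))\<^sup>2))"
    using assms(3) by simp
  moreover have "\<delta> / sqrt 2 \<le> sqrt (1 / 2)"
    using assms(2) by (simp add: real_sqrt_divide divide_right_mono)
  ultimately have "\<delta> / sqrt 2 \<le> sqrt (1 / 2 * (1 + \<gamma> k / (norm (x k - x (k - 1)))\<^sup>2))"
    by linarith
  then have "1 / Lk g x k * (\<delta> / sqrt 2)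
      \<le> 1 / Lk g x k * sqrt (1 / 2 * (1 + \<gamma> k / (norm (x k - x (k - 1)))\<^sup>2))"
    using L by (intro mult_left_mono) auto
  then have "\<delta> / (sqrt 2 * Lk g x k)
      \<le> 1 / Lk g x k * sqrt (1 / 2 * (1 + \<gamma> k / (norm (x k - x (k - 1)))\<^sup>2))"
    by (simp add: mult.commute)
  then show ?thesis
    unfolding l1_def u1_def by auto
qed

context
  fixes g :: "'a::real_inner \<Rightarrow> 'a" and x :: "nat \<Rightarrow> 'a" and t \<theta> \<gamma> :: "nat \<Rightarrow> real" and \<delta> :: real
  assumes method_run: "extended_BB_AdGD_1 g \<delta> \<gamma> x t \<theta>"
    and t0: "t 0 > 0" and \<theta>0: "\<theta> 0 \<ge> 0" and \<delta>: "0 < \<delta>" "\<delta> < 1"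
    and \<gamma>: "\<And>k. k \<ge> 1 \<Longrightarrow> \<gamma> k \<ge> 0"
begin

lemma x_Suc: "x (Suc k) = x k - t k *\<^sub>R g (x k)"
  using method_run by (simp add: extended_BB_AdGD_1_def)

lemma \<theta>_Suc: "\<theta> (Suc k) = t (Suc k) / t k"
  using method_run by (simp add: extended_BB_AdGD_1_def)

lemma step_size_between:
  "l1 \<delta> g x t \<theta> (Suc k) \<le> t (Suc k)" "t (Suc k) \<le> u1 \<gamma> g x t \<theta> (Suc k)"
proof -
  have "t (Suc k) = mid (t_BB g x (Suc k)) (l1 \<delta> g x t \<theta> (Suc k)) (u1 \<gamma> g x t \<theta> (Suc k))"
    using method_run by (simp add: extended_BB_AdGD_1_def)
  then show "l1 \<delta> g x t \<theta> (Suc k) \<le> t (Suc k)" "t (Suc k) \<le> u1 \<gamma> g x t \<theta> (Suc k)"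
    using mid_between[OF l1_le_u1[of \<delta> \<gamma> "Suc k" g x t \<theta>]] \<delta> \<gamma> by simp_all
qed

lemma step_size_and_ratio_signs: "t k > 0 \<and> \<theta> k \<ge> 0"
proof (induction k)
  case 0
  show ?case using t0 \<theta>0 by simp
next
  case (Suc k)
  have "Lk g x (Suc k) \<ge> 0" by (simp add: Lk_def)
  then have "l1 \<delta> g x t \<theta> (Suc k) > 0"
    using Suc \<delta> by (auto simp: l1_def)
  then have "t (Suc k) > 0"
    using step_size_between(1)[of k] by linarith
  then show ?case using Suc by (simp add: \<theta>_Suc)
qed

lemmas step_size_pos = step_size_and_ratio_signs[THEN conjunct1]
lemmas ratio_nonneg = step_size_and_ratio_signs[THEN conjunct2]

lemma step_size_growth: "(t (Suc k) / t k)\<^sup>2 \<le> 1 + \<theta> k"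
proof -
  have "t (Suc k) \<le> sqrt (1 + \<theta> k) * t k"
    using step_size_between(2)[of k] by (auto simp: u1_def split: if_splits)
  then have "t (Suc k) / t k \<le> sqrt (1 + \<theta> k)"
    using step_size_pos[of k] by (simp add: field_simps)
  then have "(t (Suc k) / t k)\<^sup>2 \<le> (sqrt (1 + \<theta> k))\<^sup>2"
    using step_size_pos[of k] step_size_pos[of "Suc k"] by (intro power_mono) auto
  then show ?thesis using ratio_nonneg[of k] by simp
qed

lemma scaled_gradient_change:
  assumes "g (x k) \<noteq> 0"
  shows "2 * (t (Suc k))\<^sup>2 * (norm (g (x (Suc k)) - g (x k)))\<^sup>2
    \<le> (norm (x (Suc k) - x k))\<^sup>2 + \<gamma> (Suc k)"
proof -
  define D where "D = norm (x (Suc k) - x k)"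
  define N where "N = norm (g (x (Suc k)) - g (x k))"
  have D: "D > 0"
    using assms step_size_pos[of k] by (auto simp: D_def x_Suc)
  have L: "Lk g x (Suc k) = N / D" by (simp add: Lk_def N_def D_def)
  show ?thesis
  proof (cases "Lk g x (Suc k) = 0")
    case True
    then have "N = 0" using D L by simp
    then show ?thesis using \<gamma>[of "Suc k"] by (simp add: N_def)
  next
    case False
    then have N: "N > 0" using L by (auto simp: N_def)
    define S where "S = 1 / 2 * (1 + \<gamma> (Suc k) / D\<^sup>2)"
    have S: "S \<ge> 0" using \<gamma>[of "Suc k"] by (simp add: S_def)
    have "t (Suc k) \<le> 1 / (N / D) * sqrt S"
      using step_size_between(2)[of k] False by (simp add: u1_def L S_def D_def)
    then have "t (Suc k) * N \<le> D * sqrt S"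
      using N by (simp add: field_simps)
    then have "(t (Suc k) * N)\<^sup>2 \<le> (D * sqrt S)\<^sup>2"
      using step_size_pos[of "Suc k"] N by (intro power_mono) auto
    then have "2 * ((t (Suc k))\<^sup>2 * N\<^sup>2) \<le> 2 * (D\<^sup>2 * S)"
      using S by (simp add: power_mult_distrib)
    also have "\<dots> = D\<^sup>2 + \<gamma> (Suc k)"
      using D by (simp add: S_def field_simps)
    finally show ?thesis by (simp add: N_def D_def)
  qed
qed

text \<open>
  The first argument of the minimum in \<open>l1\<close> never lets the step size shrink, as \<open>\<theta> \<ge> 0\<close>; only the second
  argument can, and it is at least \<open>\<delta> / (sqrt 2 * L)\<close> once the difference quotients of the gradient
  are at most \<open>L\<close>.
\<close>
lemma step_sizes_bounded_below:
  assumes L: "L > 0" and bound: "\<And>k. Lk g x (Suc k) \<le> L"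
  shows "min (t 0) (\<delta> / (sqrt 2 * L)) \<le> t k"
proof (induction k)
  case 0
  show ?case by simp
next
  case (Suc k)
  have "t k \<le> sqrt (1 + \<theta> k) * t k"
    using ratio_nonneg[of k] step_size_pos[of k] by simp
  moreover have "\<delta> / (sqrt 2 * L) \<le> \<delta> / (sqrt 2 * Lk g x (Suc k))" if "Lk g x (Suc k) \<noteq> 0"
  proof -
    have "Lk g x (Suc k) > 0" using that by (simp add: Lk_def)
    then show ?thesis
      using bound[of k] \<delta> L by (intro divide_left_mono) auto
  qed
  ultimately have "min (t k) (\<delta> / (sqrt 2 * L)) \<le> l1 \<delta> g x t \<theta> (Suc k)"
    unfolding l1_def by (auto simp: min_def split: if_splits)
  then show ?case
    using Suc step_size_between(1)[of k] by linarith
qed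

section \<open>The energy along the iteration\<close>

text \<open>
  This is applied twice, first with \<open>c = 0\<close>, where the gain is just the gradient inequality, to see that the
  iterates are bounded; a positive \<open>c\<close> is available only after that.
\<close>
lemma energy_bound:
  fixes f :: "'a \<Rightarrow> real"
  assumes cvx: "convex_on UNIV f" and grad: "\<And>z. GDERIV f z :> g z"
    and min: "\<And>z. f y \<le> f z"
    and sum\<gamma>: "summable (\<lambda>k. \<gamma> (Suc k))"
    and nz: "\<And>k. g (x k) \<noteq> 0"
    and gain: "\<And>k. f (x k) + g (x k) \<bullet> (y - x k) + c * (norm (g (x k)))\<^sup>2 \<le> f y"
  shows "\<exists>B. \<forall>n. (norm (x (Suc n) - y))\<^sup>2
    + (\<Sum>k<n. 2 * c * t (Suc k) * (norm (g (x (Suc k))))\<^sup>2) \<le> B"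
proof (intro exI allI)
  fix n
  define E where "E k = (norm (x (Suc k) - y))\<^sup>2 + (norm (x (Suc k) - x k))\<^sup>2
    + 2 * t k * (1 + \<theta> k) * (f (x k) - f y)" for k
  have "E (Suc k) + 2 * c * t (Suc k) * (norm (g (x (Suc k))))\<^sup>2 \<le> E k + \<gamma> (Suc k)" for k
    using energy_step[where ?x0.0 = "x k" and ?x1.0 = "x (Suc k)" and ?\<theta>0.0 = "\<theta> k",
        OF cvx grad min step_size_pos step_size_pos x_Suc x_Suc
        step_size_growth scaled_gradient_change[OF nz] gain]
    unfolding E_def \<theta>_Suc .
  then have "E n + (\<Sum>k<n. 2 * c * t (Suc k) * (norm (g (x (Suc k))))\<^sup>2) \<le> E 0 + (\<Sum>k<n. \<gamma> (Suc k))"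
    by (induction n) (simp_all, smt (verit))
  also have "(\<Sum>k<n. \<gamma> (Suc k)) \<le> (\<Sum>k. \<gamma> (Suc k))"
    using sum\<gamma> \<gamma> by (intro sum_le_suminf) auto
  finally have "E n + (\<Sum>k<n. 2 * c * t (Suc k) * (norm (g (x (Suc k))))\<^sup>2)
      \<le> E 0 + (\<Sum>k. \<gamma> (Suc k))" by simp
  moreover have "(norm (x (Suc n) - y))\<^sup>2 \<le> E n"
    using step_size_pos[of n] ratio_nonneg[of n] min[of "x n"] by (simp add: E_def)
  ultimately show "(norm (x (Suc n) - y))\<^sup>2
      + (\<Sum>k<n. 2 * c * t (Suc k) * (norm (g (x (Suc k))))\<^sup>2)
    \<le> (norm (x 1 - y))\<^sup>2 + (norm (x 1 - x 0))\<^sup>2 + 2 * t 0 * (1 + \<theta> 0) * (f (x 0) - f y)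
      + (\<Sum>k. \<gamma> (Suc k))"
    by (simp add: E_def)
qed

lemma iterates_bounded:
  fixes f :: "'a \<Rightarrow> real"
  assumes "convex_on UNIV f" and "\<And>z. GDERIV f z :> g z"
    and "\<And>z. f y \<le> f z"
    and "summable (\<lambda>k. \<gamma> (Suc k))"
    and "\<And>k. g (x k) \<noteq> 0"
  shows "bounded (range x)"
proof -
  have "f (x k) + g (x k) \<bullet> (y - x k) + 0 * (norm (g (x k)))\<^sup>2 \<le> f y" for k
    using convex_gradient_inequality[OF assms(1,2)] by simp
  then obtain B where "\<And>n. (norm (x (Suc n) - y))\<^sup>2
      + (\<Sum>k<n. 2 * 0 * t (Suc k) * (norm (g (x (Suc k))))\<^sup>2) \<le> B"
    using energy_bound[OF assms, of 0] by blast
  then have "norm (x (Suc n) - y) \<le> sqrt B" for n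
    by (simp add: real_le_rsqrt)
  then have "x k \<in> insert (x 0) (cball y (sqrt B))" for k
    by (cases k) (auto simp: dist_norm norm_minus_commute)
  moreover have "bounded (insert (x 0) (cball y (sqrt B)))" by simp
  ultimately show ?thesis
    by (meson bounded_subset image_subsetI)
qed

lemma gradient_tendsto_zero:
  fixes f :: "'a \<Rightarrow> real"
  assumes cvx: "convex_on UNIV f" and grad: "\<And>z. GDERIV f z :> g z"
    and lip: "locally_lipschitz g" and min: "\<And>z. f y \<le> f z"
    and sum\<gamma>: "summable (\<lambda>k. \<gamma> (Suc k))"
    and nz: "\<And>k. g (x k) \<noteq> 0"
    and S: "compact S" "range x \<subseteq> S"
  shows "(\<lambda>k. g (x k)) \<longlonglongrightarrow> 0"
proof -
  obtain L0 where L0: "L0-lipschitz_on S g"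
    using locally_lipschitz_compact_imp_lipschitz[OF lip S(1)] .
  define L where "L = L0 + 1"
  have L: "L > 0" and lipL: "L-lipschitz_on S g"
    using lipschitz_on_nonneg[OF L0] lipschitz_on_le[OF L0, of L] by (auto simp: L_def)
  have "Lk g x (Suc k) \<le> L" for k
  proof -
    have "norm (g (x (Suc k)) - g (x k)) \<le> L * norm (x (Suc k) - x k)"
      using lipschitz_onD[OF lipL, of "x (Suc k)" "x k"] S(2) by (auto simp: dist_norm)
    then show ?thesis
      using L by (simp add: Lk_def divide_le_eq)
  qed
  moreover define \<tau> where "\<tau> = min (t 0) (\<delta> / (sqrt 2 * L))"
  ultimately have \<tau>_le: "\<tau> \<le> t k" for k
    using step_sizes_bounded_below[OF L] by simp
  have \<tau>: "\<tau> > 0" using t0 \<delta> L by (simp add: \<tau>_def)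
  have "bounded (g ` S)"
    by (intro compact_imp_bounded compact_continuous_image lipschitz_on_continuous_on[OF lipL] S(1))
  then have "bounded (range (\<lambda>k. g (x k)))"
    by (rule bounded_subset) (use S(2) in auto)
  then obtain G where G: "\<And>k. norm (g (x k)) \<le> G"
    by (auto simp: bounded_iff)
  obtain c where c: "c > 0"
    and "\<forall>a. norm (g a) \<le> G \<longrightarrow> f a + g a \<bullet> (y - a) + c * (norm (g a))\<^sup>2 \<le> f y"
    using gradient_inequality_at_minimiser[OF cvx grad lip min, of G] by blast
  then have gain: "f (x k) + g (x k) \<bullet> (y - x k) + c * (norm (g (x k)))\<^sup>2 \<le> f y" for k
    using G by blast
  define w where "w k = 2 * c * t (Suc k) * (norm (g (x (Suc k))))\<^sup>2" for k
  have w_nonneg: "w k \<ge> 0" for k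
    using c step_size_pos[of "Suc k"] by (simp add: w_def)
  have "\<exists>B. \<forall>n. (norm (x (Suc n) - y))\<^sup>2 + (\<Sum>k<n. w k) \<le> B"
    unfolding w_def by (rule energy_bound[OF cvx grad min sum\<gamma> nz gain])
  then obtain B where B: "\<And>n. (norm (x (Suc n) - y))\<^sup>2 + (\<Sum>k<n. w k) \<le> B"
    by blast
  have "(\<Sum>k<n. w k) \<le> B" for n
    using B[of n] zero_le_power2[of "norm (x (Suc n) - y)"] by linarith
  then have "summable w"
    by (rule summableI_nonneg_bounded[OF w_nonneg])
  then have "w \<longlonglongrightarrow> 0" by (rule summable_LIMSEQ_zero)
  then have "(\<lambda>k. w k / (2 * c * \<tau>)) \<longlonglongrightarrow> 0"
    by (rule tendsto_divide_zero)
  moreover have "(norm (g (x (Suc k))))\<^sup>2 \<le> w k / (2 * c * \<tau>)" for k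
  proof -
    have "2 * c * \<tau> * (norm (g (x (Suc k))))\<^sup>2 \<le> w k"
      unfolding w_def using c \<tau>_le[of "Suc k"] by (intro mult_right_mono mult_left_mono) auto
    then show ?thesis using c \<tau> by (simp add: field_simps)
  qed
  ultimately have "(\<lambda>k. (norm (g (x (Suc k))))\<^sup>2) \<longlonglongrightarrow> 0"
    using Lim_null_comparison[of "\<lambda>k. (norm (g (x (Suc k))))\<^sup>2" "\<lambda>k. w k / (2 * c * \<tau>)"
        sequentially]
    by simp
  then have "(\<lambda>k. sqrt ((norm (g (x (Suc k))))\<^sup>2)) \<longlonglongrightarrow> sqrt 0"
    by (rule tendsto_real_sqrt)
  then have "(\<lambda>k. g (x (Suc k))) \<longlonglongrightarrow> 0"
    by (simp add: tendsto_norm_zero_iff)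
  then show ?thesis by (rule LIMSEQ_imp_Suc)
qed

end

section \<open>Accumulation points are optimal\<close>

theorem mainTheorem3:
  fixes f :: "real ^ 'd \<Rightarrow> real"
    and grad_f :: "real ^ 'd \<Rightarrow> real ^ 'd"
    and x :: "nat \<Rightarrow> real ^ 'd"
    and t \<theta> \<gamma> :: "nat \<Rightarrow> real"
    and \<delta> :: real
  assumes "convex_on UNIV f"
    and "\<And>y. GDERIV f y :> grad_f y"
    and "locally_lipschitz grad_f"
    and "\<exists>y. \<forall>z. f y \<le> f z"
    and "t 0 > 0"
    and "\<theta> 0 \<ge> 0"
    and "0 < \<delta>" and "\<delta> < 1"
    and "\<And>k. k \<ge> 1 \<Longrightarrow> \<gamma> k \<ge> 0"
    and "summable (\<lambda>k. \<gamma> (Suc k))"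
    and "extended_BB_AdGD_1 grad_f \<delta> \<gamma> x t \<theta>"
    and "\<And>k. grad_f (x k) \<noteq> 0"
  shows "\<forall>z. accumulation_point x z \<longrightarrow> (\<forall>y. f z \<le> f y)"
proof (intro allI impI)
  fix z y
  assume "accumulation_point x z"
  then obtain r where r: "strict_mono r" "(x \<circ> r) \<longlonglongrightarrow> z"
    unfolding accumulation_point_def by blast
  obtain y0 where min: "\<And>z. f y0 \<le> f z" using assms(4) by blast
  have "bounded (range x)"
    by (rule iterates_bounded[OF assms(11,5-9,1,2) min assms(10,12)])
  then have "compact (closure (range x))"
    by (simp add: compact_closure)
  then have "(\<lambda>k. grad_f (x k)) \<longlonglongrightarrow> 0"
    using closure_subset[of "range x"] assms min
    by (intro gradient_tendsto_zero[where f = f and g = grad_f and x = x and t = t and \<theta> = \<theta>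
          and \<gamma> = \<gamma> and \<delta> = \<delta> and y = y0 and S = "closure (range x)"])
  then have "(\<lambda>k. grad_f ((x \<circ> r) k)) \<longlonglongrightarrow> 0"
    using LIMSEQ_subseq_LIMSEQ[OF _ r(1)] by (force simp: o_def)
  moreover have "(\<lambda>k. grad_f ((x \<circ> r) k)) \<longlonglongrightarrow> grad_f z"
    using locally_lipschitz_imp_continuous[OF assms(3)] r(2) by (rule isCont_tendsto_compose)
  ultimately have "grad_f z = 0"
    using LIMSEQ_unique by blast
  then show "f z \<le> f y"
    using convex_minimiser_iff_gradient_zero[OF assms(1,2)] by blast
qed

end
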